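(* Let $\mathcal{P}$ be a finite poset and let $\mathcal{X}=\{\mathbb{I}_{\langle a,b\rangle}\mid a\leq b\in\mathcal{P}\}$ be the set of segment modules. Let $a\leq b$ and $c\leq d$ in $\mathcal{P}$. There is an $\mathcal{X}$-irreducible morphism $\mathbb{I}_{\langle a,b\rangle}\to\mathbb{I}_{\langle c,d\rangle}$ if and only if there is a morphism $f:\mathbb{I}_{\langle a,b\rangle}\to\mathbb{I}_{\langle c,d\rangle}$ for which one of the following holds: 1. $f$ is injective and $c\lessdot a\leq d=b$. 2. $f$ is surjective and $c=a\leq d\lessdot b$.
   Context: Fix a field $\mathbb{K}$. A representation of $\mathcal{P}$ is a functor from $\mathcal{P}$ (viewed as a category with a unique morphism $x\to y$ whenever $x\leq y$) to $\mathbb{K}$-vector spaces; $\mathrm{rep}\,\mathcal{P}$ is the category of finitely presentable representations (for $\mathcal{P}$ finite: pointwise finite-dimensional ones). For $a\leq b$ the segment is $\langle a,b\rangle=\{c\in\mathcal{P}\mid a\leq c\leq b\}$, and $\mathbb{I}_{\mathcal{S}}$ denotes the indicator representation of a convex connected subset $\mathcal{S}$: $\mathbb{I}_{\mathcal{S}}(x)=\mathbb{K}$ for $x\in\mathcal{S}$ and $0$ otherwise, with $\mathbb{I}_{\mathcal{S}}(x,y)=1_{\mathbb{K}}$ for $x\leq y$ both in $\mathcal{S}$ and $0$ otherwise. For $x,z\in\mathcal{P}$, $x\lessdot z$ means $z$ covers $x$: $x<z$ and there is no $y$ with $x<y<z$. $\mathrm{add}(\mathcal{X})$ is the class of finite direct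 sums of direct summands of objects of $\mathcal{X}$. A morphism $f:X\to X'$ with $X,X'\in\mathcal{X}$ is $\mathcal{X}$-irreducible if $f$ is neither a section (split monomorphism) nor a retraction (split epimorphism), and for every factorisation $f=h\circ g$ with $X\xrightarrow{g}U\xrightarrow{h}X'$ and $U\in\mathrm{add}(\mathcal{X})$, $g$ is a section or $h$ is a retraction. *)

theory Defs
  imports Complex_Main "HOL-Library.Function_Algebras"
begin

text \<open>
  Vector spaces over a field are taken to be subspaces of the fixed space of sequences
  \<^typ>\<open>nat \<Rightarrow> 'k\<close> (with pointwise operations), so that one can quantify over all
  representations inside a definition. As this space is infinite-dimensional, every
  finite-dimensional vector space has an isomorphic copy among its subspaces.
\<close>

definition fscale :: "'k::field \<Rightarrow> (nat \<Rightarrow> 'k) \<Rightarrow> (nat \<Rightarrow> 'k)" where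
  "fscale c v = (\<lambda>i. c * v i)"

global_interpretation seq: vector_space "fscale :: 'k::field \<Rightarrow> (nat \<Rightarrow> 'k) \<Rightarrow> (nat \<Rightarrow> 'k)"
  by unfold_locales (auto simp: fscale_def fun_eq_iff algebra_simps)

definition fin_dim_subspace :: "(nat \<Rightarrow> 'k::field) set \<Rightarrow> bool" where
  "fin_dim_subspace V \<longleftrightarrow> seq.subspace V \<and> (\<exists>B. finite B \<and> V = seq.span B)"

text \<open>
  Linear maps are total HOL functions of which only the values on the domain \<open>V\<close> matter;
  equality of such maps is always stated as agreement on the domain.
\<close>

definition linear_between ::
  "(nat \<Rightarrow> 'k::field) set \<Rightarrow> (nat \<Rightarrow> 'k) set \<Rightarrow> ((nat \<Rightarrow> 'k) \<Rightarrow> (nat \<Rightarrow> 'k)) \<Rightarrow> bool" where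
  "linear_between V W f \<longleftrightarrow>
     (\<forall>v\<in>V. f v \<in> W) \<and>
     (\<forall>v\<in>V. \<forall>w\<in>V. f (v + w) = f v + f w) \<and>
     (\<forall>c. \<forall>v\<in>V. f (fscale c v) = fscale c (f v))"

text \<open>
  \<open>trans_map M x y\<close> is the structure map of \<open>M\<close> for \<open>x \<le> y\<close>; its values for other
  \<open>x\<close>, \<open>y\<close> are irrelevant.
\<close>

record ('p, 'k) prep =
  space :: "'p \<Rightarrow> (nat \<Rightarrow> 'k) set"
  trans_map :: "'p \<Rightarrow> 'p \<Rightarrow> (nat \<Rightarrow> 'k) \<Rightarrow> (nat \<Rightarrow> 'k)"

definition is_rep :: "('p::order, 'k::field) prep \<Rightarrow> bool" where
  "is_rep M \<longleftrightarrow>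
     (\<forall>x. fin_dim_subspace (space M x)) \<and>
     (\<forall>x y. x \<le> y \<longrightarrow> linear_between (space M x) (space M y) (trans_map M x y)) \<and>
     (\<forall>x. \<forall>v\<in>space M x. trans_map M x x v = v) \<and>
     (\<forall>x y z. x \<le> y \<longrightarrow> y \<le> z \<longrightarrow>
        (\<forall>v\<in>space M x. trans_map M x z v = trans_map M y z (trans_map M x y v)))"

type_synonym ('p, 'k) family = "'p \<Rightarrow> (nat \<Rightarrow> 'k) \<Rightarrow> (nat \<Rightarrow> 'k)"

definition morphism ::
  "('p::order, 'k::field) prep \<Rightarrow> ('p, 'k) prep \<Rightarrow> ('p, 'k) family \<Rightarrow> bool" where
  "morphism M N f \<longleftrightarrow>
     (\<forall>x. linear_between (space M x) (space N x) (f x)) \<and>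
     (\<forall>x y. x \<le> y \<longrightarrow>
        (\<forall>v\<in>space M x. f y (trans_map M x y v) = trans_map N x y (f x v)))"

definition injective :: "('p, 'k) prep \<Rightarrow> ('p, 'k) family \<Rightarrow> bool" where
  "injective M f \<longleftrightarrow> (\<forall>x. inj_on (f x) (space M x))"

definition surjective :: "('p, 'k) prep \<Rightarrow> ('p, 'k) prep \<Rightarrow> ('p, 'k) family \<Rightarrow> bool" where
  "surjective M N f \<longleftrightarrow> (\<forall>x. f x ` space M x = space N x)"

definition is_section ::
  "('p::order, 'k::field) prep \<Rightarrow> ('p, 'k) prep \<Rightarrow> ('p, 'k) family \<Rightarrow> bool" where
  "is_section M N f \<longleftrightarrow>
     (\<exists>r. morphism N M r \<and> (\<forall>x. \<forall>v\<in>space M x. r x (f x v) = v))"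

definition is_retraction ::
  "('p::order, 'k::field) prep \<Rightarrow> ('p, 'k) prep \<Rightarrow> ('p, 'k) family \<Rightarrow> bool" where
  "is_retraction M N f \<longleftrightarrow>
     (\<exists>s. morphism N M s \<and> (\<forall>x. \<forall>w\<in>space N x. f x (s x w) = w))"

text \<open>
  \<open>U\<close> is, up to isomorphism, the direct sum of the representations in the list \<open>Ys\<close>,
  with inclusions \<open>\<iota> i\<close> and projections \<open>\<pi> i\<close>. For the empty list this says \<open>U = 0\<close>.
\<close>

definition is_direct_sum :: "('p::order, 'k::field) prep \<Rightarrow> ('p, 'k) prep list \<Rightarrow> bool" where
  "is_direct_sum U Ys \<longleftrightarrow>
     (\<exists>\<iota> \<pi>.
        (\<forall>i<length Ys. morphism (Ys ! i) U (\<iota> i) \<and> morphism U (Ys ! i) (\<pi> i)) \<and>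
        (\<forall>i<length Ys. \<forall>j<length Ys. \<forall>x. \<forall>v\<in>space (Ys ! i) x.
           \<pi> j x (\<iota> i x v) = (if i = j then v else 0)) \<and>
        (\<forall>x. \<forall>u\<in>space U x. (\<Sum>i<length Ys. \<iota> i x (\<pi> i x u)) = u))"

definition direct_summand :: "('p::order, 'k::field) prep \<Rightarrow> ('p, 'k) prep \<Rightarrow> bool" where
  "direct_summand Y M \<longleftrightarrow> is_rep Y \<and> (\<exists>Z. is_rep Z \<and> is_direct_sum M [Y, Z])"

definition add_closure :: "('p::order, 'k::field) prep set \<Rightarrow> ('p, 'k) prep set" where
  "add_closure \<X> = {U. is_rep U \<and>
     (\<exists>Ys. (\<forall>Y\<in>set Ys. \<exists>M\<in>\<X>. direct_summand Y M) \<and> is_direct_sum U Ys)}"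

definition irreducible_morphism ::
  "('p::order, 'k::field) prep set \<Rightarrow> ('p, 'k) prep \<Rightarrow> ('p, 'k) prep \<Rightarrow>
   ('p, 'k) family \<Rightarrow> bool" where
  "irreducible_morphism \<X> M N f \<longleftrightarrow>
     M \<in> \<X> \<and> N \<in> \<X> \<and> morphism M N f \<and>
     \<not> is_section M N f \<and> \<not> is_retraction M N f \<and>
     (\<forall>U\<in>add_closure \<X>. \<forall>g h. morphism M U g \<longrightarrow> morphism U N h \<longrightarrow>
        (\<forall>x. \<forall>v\<in>space M x. f x v = h x (g x v)) \<longrightarrow>
        is_section M U g \<or> is_retraction U N h)"

text \<open>The field, as a one-dimensional space, is the line of sequences supported at \<open>0\<close>.\<close>

definition base_line :: "(nat \<Rightarrow> 'k::field) set" where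
  "base_line = {v. \<forall>i>0. v i = 0}"

definition indicator_rep :: "'p::order set \<Rightarrow> ('p, 'k::field) prep" where
  "indicator_rep S =
     \<lparr>space = (\<lambda>x. if x \<in> S then base_line else {0}),
      trans_map = (\<lambda>x y v. if x \<in> S \<and> y \<in> S then v else 0)\<rparr>"

definition segment_modules :: "('p::order, 'k::field) prep set" where
  "segment_modules = {indicator_rep {a..b} | a b. a \<le> b}"

definition covered_by :: "'p::order \<Rightarrow> 'p \<Rightarrow> bool" (infix "\<lessdot>" 50) where
  "x \<lessdot> z \<longleftrightarrow> x < z \<and> \<not> (\<exists>y. x < y \<and> y < z)"

lemma fin_dim_base_line: "fin_dim_subspace (base_line :: (nat \<Rightarrow> 'k::field) set)"
proof -
  define e :: "nat \<Rightarrow> 'k" where "e = (\<lambda>i. if i = 0 then 1 else 0)"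
  have "base_line = range (\<lambda>c. fscale c e)"
  proof (intro equalityI subsetI)
    fix v :: "nat \<Rightarrow> 'k" assume "v \<in> base_line"
    then have "v = fscale (v 0) e"
      by (auto simp: base_line_def fscale_def e_def fun_eq_iff)
    then show "v \<in> range (\<lambda>c. fscale c e)" by blast
  qed (auto simp: base_line_def fscale_def e_def)
  then have *: "base_line = seq.span {e}"
    by (simp add: seq.span_singleton)
  have "seq.subspace (base_line :: (nat \<Rightarrow> 'k) set)"
    unfolding * by (rule seq.subspace_span)
  with * show ?thesis
    unfolding fin_dim_subspace_def by (metis finite.emptyI finite.insertI)
qed

lemma is_rep_segment: "is_rep (indicator_rep {a..b} :: ('p::order, 'k::field) prep)"
proof -
  have "fin_dim_subspace ({0} :: (nat \<Rightarrow> 'k) set)"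
    unfolding fin_dim_subspace_def
    by (metis finite.emptyI seq.span_empty seq.subspace_span)
  moreover have "(0 :: nat \<Rightarrow> 'k) \<in> base_line" by (simp add: base_line_def)
  ultimately show ?thesis
    using fin_dim_base_line
    by (auto simp: is_rep_def indicator_rep_def linear_between_def fscale_def fun_eq_iff)
qed

end

theory Submission
  imports Defs
begin

text \<open>
  A morphism \<open>I\<langle>a,b\<rangle> \<rightarrow> I\<langle>c,d\<rangle>\<close> is multiplication by one scalar on \<open>\<langle>a,d\<rangle>\<close>, and it can be
  nonzero only if \<open>c \<le> a \<le> d \<le> b\<close>. Hence a section or retraction between segment modules
  forces equality of the segments, and a nonzero morphism factors through \<open>I\<langle>e,k\<rangle>\<close> exactly when
  \<open>c \<le> e \<le> a\<close> and \<open>d \<le> k \<le> b\<close>. A nonzero composite through an object of \<open>add(X)\<close> is nonzero on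
  some summand, hence nonzero through some segment module \<open>I\<langle>e,k\<rangle>\<close>. So an irreducible morphism
  exists iff \<open>(a,b)\<close> and \<open>(c,d)\<close> are distinct and are the only pairs \<open>(e,k)\<close> in this range; since
  \<open>(a,d)\<close> is such a pair, this leaves the two covering cases.
\<close>

section \<open>Pointwise calculus of morphisms\<close>

lemma morphism_in_space: "morphism M N f \<Longrightarrow> v \<in> space M x \<Longrightarrow> f x v \<in> space N x"
  by (auto simp: morphism_def linear_between_def)

lemma morphism_add:
  "morphism M N f \<Longrightarrow> v \<in> space M x \<Longrightarrow> w \<in> space M x \<Longrightarrow> f x (v + w) = f x v + f x w"
  by (auto simp: morphism_def linear_between_def)

lemma morphism_fscale:
  "morphism M N f \<Longrightarrow> v \<in> space M x \<Longrightarrow> f x (fscale r v) = fscale r (f x v)"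
  by (auto simp: morphism_def linear_between_def)

lemma morphism_natural:
  "morphism M N f \<Longrightarrow> x \<le> y \<Longrightarrow> v \<in> space M x \<Longrightarrow>
     f y (trans_map M x y v) = trans_map N x y (f x v)"
  by (auto simp: morphism_def)

lemma fscale_0_left [simp]: "fscale 0 v = 0"
  by (simp add: fscale_def fun_eq_iff)

lemma is_rep_subspace: "is_rep M \<Longrightarrow> seq.subspace (space M x)"
  by (auto simp: is_rep_def fin_dim_subspace_def)

lemma zero_in_space: "is_rep M \<Longrightarrow> 0 \<in> space M x"
  using is_rep_subspace seq.subspace_0 by blast

lemma morphism_zero: "is_rep M \<Longrightarrow> morphism M N f \<Longrightarrow> f x 0 = 0"
  using morphism_fscale[of M N f 0 x 0] zero_in_space[of M x] by simp

lemma morphism_sum: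
  assumes "is_rep M" "morphism M N f" "finite I" "\<And>i. i \<in> I \<Longrightarrow> u i \<in> space M x"
  shows "f x (\<Sum>i\<in>I. u i) = (\<Sum>i\<in>I. f x (u i))"
  using assms(3,4)
proof (induction I rule: finite_induct)
  case empty
  then show ?case using morphism_zero[OF assms(1,2)] by (simp only: sum.empty)
next
  case (insert i I)
  have "(\<Sum>i\<in>I. u i) \<in> space M x"
    using insert.prems by (intro seq.subspace_sum is_rep_subspace assms(1)) auto
  then have "f x (u i + (\<Sum>i\<in>I. u i)) = f x (u i) + f x (\<Sum>i\<in>I. u i)"
    using insert.prems by (intro morphism_add[OF assms(2)]) auto
  also have "f x (\<Sum>i\<in>I. u i) = (\<Sum>i\<in>I. f x (u i))"
    by (rule insert.IH) (simp add: insert.prems)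
  finally show ?case
    by (simp only: sum.insert[OF insert.hyps])
qed

lemma morphism_id: "is_rep M \<Longrightarrow> morphism M M (\<lambda>x v. v)"
  by (simp add: morphism_def linear_between_def)

lemma morphism_comp:
  "morphism L M f \<Longrightarrow> morphism M N g \<Longrightarrow> morphism L N (\<lambda>x v. g x (f x v))"
  by (simp add: morphism_def linear_between_def)

lemma morphism_fscale_comp:
  assumes N: "is_rep N" and f: "morphism M N f"
  shows "morphism M N (\<lambda>x v. fscale r (f x v))"
proof -
  have "fscale r (f x v) \<in> space N x" if "v \<in> space M x" for x v
    by (rule seq.subspace_scale[OF is_rep_subspace[OF N] morphism_in_space[OF f that]])
  moreover have "fscale r (f x (v + w)) = fscale r (f x v) + fscale r (f x w)"
    if "v \<in> space M x" "w \<in> space M x" for x v w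
    by (simp only: morphism_add[OF f that] seq.scale_right_distrib)
  moreover have "fscale r (f x (fscale s v)) = fscale s (fscale r (f x v))"
    if "v \<in> space M x" for x s v
    by (simp only: morphism_fscale[OF f that] seq.scale_left_commute)
  moreover have "fscale r (f y (trans_map M x y v)) = trans_map N x y (fscale r (f x v))"
    if "x \<le> y" "v \<in> space M x" for x y v
    using N that(1) morphism_in_space[OF f that(2)] morphism_natural[OF f that]
    unfolding is_rep_def linear_between_def by metis
  ultimately show ?thesis
    unfolding morphism_def linear_between_def by blast
qed

section \<open>The zero representation, direct summands and the additive closure\<close>

definition zero_rep :: "('p::order, 'k::field) prep" where
  "zero_rep = \<lparr>space = (\<lambda>x. {0}), trans_map = (\<lambda>x y v. 0)\<rparr>"

lemma is_rep_zero_rep: "is_rep zero_rep"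
proof -
  have "fin_dim_subspace ({0} :: (nat \<Rightarrow> 'k::field) set)"
    unfolding fin_dim_subspace_def
    by (metis finite.emptyI seq.span_empty seq.subspace_span)
  then show ?thesis
    by (simp add: is_rep_def zero_rep_def linear_between_def)
qed

lemma morphism_to_zero_rep: "morphism M zero_rep (\<lambda>x v. 0)"
  by (simp add: morphism_def linear_between_def zero_rep_def)

lemma morphism_from_zero_rep: "is_rep N \<Longrightarrow> morphism zero_rep N (\<lambda>x v. 0)"
  \<comment> \<open>The zero endomorphism of \<open>N\<close> is 0 times the identity; its
    naturality says that the structure maps of \<open>N\<close> send 0 to 0.\<close>
  using morphism_fscale_comp[OF _ morphism_id, of N 0] zero_in_space[of N]
  by (auto simp: morphism_def linear_between_def zero_rep_def)

lemma zero_rep_in_add_closure: "zero_rep \<in> add_closure X"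
proof -
  have "is_direct_sum zero_rep []"
    by (simp add: is_direct_sum_def zero_rep_def)
  then show ?thesis
    unfolding add_closure_def using is_rep_zero_rep by force
qed

text \<open>The complement is \<open>zero_rep\<close>: index 0 carries the identity and index 1 the
  zero maps.\<close>

lemma direct_summand_refl:
  assumes "is_rep M"
  shows "direct_summand M M"
proof -
  have "is_direct_sum M [M, zero_rep]"
    unfolding is_direct_sum_def
    by (rule exI[of _ "\<lambda>i x v. if i = 0 then v else 0"],
        rule exI[of _ "\<lambda>i x v. if i = 0 then v else 0"])
       (use morphism_id[OF assms] morphism_to_zero_rep[of M] morphism_from_zero_rep[OF assms]
        in \<open>auto simp: less_Suc_eq nth_Cons' zero_rep_def\<close>)
  then show ?thesis
    unfolding direct_summand_def using assms is_rep_zero_rep by blast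
qed

lemma in_add_closure:
  assumes "is_rep M" "M \<in> X"
  shows "M \<in> add_closure X"
proof -
  have "is_direct_sum M [M]"
    unfolding is_direct_sum_def
    by (rule exI[of _ "\<lambda>i x v. v"], rule exI[of _ "\<lambda>i x v. v"])
       (use morphism_id[OF assms(1)] in auto)
  then show ?thesis
    unfolding add_closure_def using assms direct_summand_refl[OF assms(1)]
    by (intro CollectI conjI exI[of _ "[M]"]) auto
qed

lemma direct_summand_retract:
  assumes "direct_summand Y L"
  obtains j p where "morphism Y L j" "morphism L Y p"
    "\<And>x v. v \<in> space Y x \<Longrightarrow> p x (j x v) = v"
proof -
  obtain Z \<iota> \<pi> where
    "\<forall>i<length [Y, Z]. morphism ([Y, Z] ! i) L (\<iota> i) \<and> morphism L ([Y, Z] ! i) (\<pi> i)"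
    "\<forall>i<length [Y, Z]. \<forall>j<length [Y, Z]. \<forall>x. \<forall>v\<in>space ([Y, Z] ! i) x.
       \<pi> j x (\<iota> i x v) = (if i = j then v else 0)"
    using assms unfolding direct_summand_def is_direct_sum_def by blast
  then have "morphism Y L (\<iota> 0)" "morphism L Y (\<pi> 0)"
    "\<And>x v. v \<in> space Y x \<Longrightarrow> \<pi> 0 x (\<iota> 0 x v) = v"
    by force+
  then show thesis by (rule that)
qed

text \<open>The identity of \<open>U\<close> is the sum of the maps \<open>\<iota> i\<close> after
  \<open>\<pi> i\<close>, so a nonzero value of the composite has a nonzero term. Its summand
  \<open>Ys ! i\<close> is a retract of some \<open>L\<close> in \<open>X\<close>, and inserting the
  identity of \<open>Ys ! i\<close>, written as \<open>p\<close> after \<open>j\<close>, makes that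
  term pass through \<open>L\<close>.\<close>

lemma nonzero_composite_through_generator:
  assumes U: "U \<in> add_closure X"
    and g: "morphism M U g" and h: "morphism U N h"
    and v: "v \<in> space M x" and nz: "h x (g x v) \<noteq> 0"
  obtains L j p where "L \<in> X" "morphism U L j" "morphism L U p"
    "h x (p x (j x (g x v))) \<noteq> 0"
proof -
  obtain Ys \<iota> \<pi> where rep: "is_rep U"
    and Ys: "\<forall>Y\<in>set Ys. \<exists>M\<in>X. direct_summand Y M"
    and mor: "\<forall>i<length Ys. morphism (Ys ! i) U (\<iota> i) \<and> morphism U (Ys ! i) (\<pi> i)"
    and total: "\<forall>x. \<forall>u\<in>space U x. (\<Sum>i<length Ys. \<iota> i x (\<pi> i x u)) = u"
    using U unfolding add_closure_def is_direct_sum_def by blast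
  have gv: "g x v \<in> space U x" by (rule morphism_in_space[OF g v])
  have part: "\<iota> i x (\<pi> i x (g x v)) \<in> space U x" if "i < length Ys" for i
    using mor that gv morphism_in_space by metis
  have "h x (g x v) = h x (\<Sum>i<length Ys. \<iota> i x (\<pi> i x (g x v)))"
    using total gv by simp
  also have "\<dots> = (\<Sum>i<length Ys. h x (\<iota> i x (\<pi> i x (g x v))))"
    using part by (intro morphism_sum[OF rep h]) auto
  finally obtain i where i: "i < length Ys" "h x (\<iota> i x (\<pi> i x (g x v))) \<noteq> 0"
    using nz by (metis (no_types, lifting) lessThan_iff sum.neutral)
  obtain L where L: "L \<in> X" "direct_summand (Ys ! i) L"
    using Ys i(1) nth_mem by blast
  obtain j p where jp: "morphism (Ys ! i) L j" "morphism L (Ys ! i) p"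
    "\<And>x v. v \<in> space (Ys ! i) x \<Longrightarrow> p x (j x v) = v"
    using direct_summand_retract[OF L(2)] by blast
  show thesis
  proof (rule that[OF L(1)])
    show "morphism U L (\<lambda>x v. j x (\<pi> i x v))"
      using mor i(1) jp(1) morphism_comp by blast
    show "morphism L U (\<lambda>x v. \<iota> i x (p x v))"
      using mor i(1) jp(2) morphism_comp by blast
    have "\<pi> i x (g x v) \<in> space (Ys ! i) x"
      using mor i(1) gv morphism_in_space by metis
    then show "h x (\<iota> i x (p x (j x (\<pi> i x (g x v))))) \<noteq> 0"
      using jp(3) i(2) by simp
  qed
qed

subsection \<open>Morphisms between segment modules\<close>

definition base_unit :: "nat \<Rightarrow> 'k::field" where
  "base_unit = (\<lambda>i. if i = 0 then 1 else 0)"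

lemma base_unit_in_base_line: "base_unit \<in> base_line"
  by (simp add: base_unit_def base_line_def)

lemma base_unit_nonzero: "base_unit \<noteq> 0"
  by (auto simp: base_unit_def fun_eq_iff)

lemma zero_in_base_line: "0 \<in> base_line"
  by (simp add: base_line_def)

lemma base_line_eq_fscale: "v \<in> base_line \<Longrightarrow> v = fscale (v 0) base_unit"
  by (auto simp: base_line_def fscale_def base_unit_def fun_eq_iff)

lemma space_indicator [simp]:
  "space (indicator_rep S) x = (if x \<in> S then base_line else {0})"
  by (simp add: indicator_rep_def)

lemma trans_map_indicator [simp]:
  "trans_map (indicator_rep S) x y v = (if x \<in> S \<and> y \<in> S then v else 0)"
  by (simp add: indicator_rep_def)

text \<open>The source is generated at its least point \<open>a\<close>, so \<open>f\<close> is
  already nonzero at \<open>a\<close>, which puts \<open>a\<close> into the target segment.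
  Transporting that value up to \<open>d\<close> gives the remaining inequality.\<close>

lemma nonzero_segment_morphism:
  fixes f :: "('p::order, 'k::field) family"
  assumes f: "morphism (indicator_rep {a..b} :: ('p, 'k) prep) (indicator_rep {c..d}) f"
    and v: "v \<in> space (indicator_rep {a..b} :: ('p, 'k) prep) x" and nz: "f x v \<noteq> 0"
  shows "c \<le> a \<and> a \<le> d \<and> d \<le> b"
proof -
  let ?M = "indicator_rep {a..b} :: ('p, 'k) prep"
  let ?N = "indicator_rep {c..d} :: ('p, 'k) prep"
  have x: "x \<in> {a..b}"
    using v nz morphism_zero[OF is_rep_segment f] by (auto split: if_splits)
  then have ab: "a \<le> b" by (auto intro: order_trans)
  then have va: "v \<in> space ?M a" using v x by auto
  have "f x v = trans_map ?N a x (f a v)"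
    using morphism_natural[OF f _ va, of x] x ab by simp
  then have a: "a \<in> {c..d}" and fa: "f a v \<noteq> 0"
    using nz by (auto split: if_splits)
  \<comment> \<open>The target's structure map from \<open>a\<close> to \<open>d\<close> is the
    identity, so the nonzero value survives at \<open>d\<close>; the source therefore cannot vanish
    there.\<close>
  have "f d (trans_map ?M a d v) = f a v"
    using morphism_natural[OF f _ va, of d] a by auto
  then have "d \<in> {a..b}"
    using fa morphism_zero[OF is_rep_segment f] by (auto split: if_splits)
  then show ?thesis using a by simp
qed

text \<open>By naturality along \<open>a \<le> x\<close>, the whole family is determined by its
  component at \<open>a\<close>, a linear map between lines. A zero morphism gets the scalar
  0.\<close>

lemma segment_morphism_scalar:
  fixes f :: "('p::order, 'k::field) family"
  assumes f: "morphism (indicator_rep {a..b} :: ('p, 'k) prep) (indicator_rep {c..d}) f"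
  obtains r where "\<And>x v. v \<in> space (indicator_rep {a..b} :: ('p, 'k) prep) x \<Longrightarrow>
    f x v = (if x \<in> {c..d} then fscale r v else 0)"
proof -
  let ?M = "indicator_rep {a..b} :: ('p, 'k) prep"
  let ?N = "indicator_rep {c..d} :: ('p, 'k) prep"
  show thesis
  proof (cases "\<exists>x. \<exists>v\<in>space ?M x. f x v \<noteq> 0")
    case False
    then show thesis by (intro that[of 0]) auto
  next
    case True
    then have le: "c \<le> a" "a \<le> d" "d \<le> b"
      using nonzero_segment_morphism[OF f] by blast+
    \<comment> \<open>The scalar is the only possibly nonzero coordinate of the image of the
      generator.\<close>
    define r where "r = f a base_unit 0"
    have fa: "f a v = fscale r v" if "v \<in> base_line" for v
    proof -
      have ua: "base_unit \<in> space ?M a"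
        using le base_unit_in_base_line by auto
      have "f a base_unit \<in> base_line"
        using morphism_in_space[OF f ua] zero_in_base_line le by auto
      then have "f a base_unit = fscale r base_unit"
        unfolding r_def by (rule base_line_eq_fscale)
      then have "f a (fscale (v 0) base_unit) = fscale r (fscale (v 0) base_unit)"
        using morphism_fscale[OF f ua] by (simp add: mult.commute)
      then show ?thesis using base_line_eq_fscale[OF that] by simp
    qed
    show thesis
    proof (rule that[of r])
      fix x v assume v: "v \<in> space ?M x"
      show "f x v = (if x \<in> {c..d} then fscale r v else 0)"
      proof (cases "x \<in> {a..b}")
        case False
        then have "v = 0" using v by (auto split: if_splits)
        then show ?thesis
          using morphism_zero[OF is_rep_segment f] by simp
      next
        case True
        moreover from this have "a \<le> b" by (auto intro: order_trans)
        ultimately have "f x v = trans_map ?N a x (f a v)"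
          using morphism_natural[OF f, of a x v] v by simp
        then show ?thesis using True v le fa by auto
      qed
    qed
  qed
qed

lemma segment_morphism_canonical:
  assumes "c \<le> a" "d \<le> b"
  shows "morphism (indicator_rep {a..b} :: ('p::order, 'k::field) prep) (indicator_rep {c..d})
    (\<lambda>x v. if x \<in> {c..d} then v else 0)"
proof -
  let ?M = "indicator_rep {a..b} :: ('p, 'k) prep"
  let ?N = "indicator_rep {c..d} :: ('p, 'k) prep"
  let ?f = "(\<lambda>x v. if x \<in> {c..d} then v else 0) :: ('p, 'k) family"
  have "linear_between (space ?M x) (space ?N x) (?f x)" for x
    using zero_in_base_line by (cases "x \<in> {c..d}") (auto simp: linear_between_def)
  moreover have "?f y (trans_map ?M x y v) = trans_map ?N x y (?f x v)"
    if xy: "x \<le> y" and v: "v \<in> space ?M x" for x y v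
  \<comment> \<open>Here \<open>c \<le> a \<le> x \<le> y \<le> d \<le> b\<close>, so both points
    lie in both segments and every map is the identity. In all other cases both sides
    vanish.\<close>
  proof (cases "x \<in> {a..b} \<and> y \<in> {c..d}")
    case True
    then have "x \<in> {c..d} \<and> y \<in> {a..b}"
      using xy assms order_trans[of c a x] order_trans[of a x y] order_trans[of x y d]
        order_trans[of y d b] by simp
    then show ?thesis using True by simp
  next
    case False
    then show ?thesis using v by (auto split: if_splits)
  qed
  ultimately show ?thesis unfolding morphism_def by blast
qed

text \<open>Endomorphisms of a segment module are scalars, so a nonzero one is invertible. This is
  what turns nonzero composites into sections and retractions.\<close>

lemma nonzero_segment_endomorphism_scalar:
  fixes f :: "('p::order, 'k::field) family"
  assumes f: "morphism (indicator_rep {a..b} :: ('p, 'k) prep) (indicator_rep {a..b}) f"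
    and v: "v \<in> space (indicator_rep {a..b} :: ('p, 'k) prep) x" and nz: "f x v \<noteq> 0"
  obtains r where "r \<noteq> 0"
    "\<And>x v. v \<in> space (indicator_rep {a..b} :: ('p, 'k) prep) x \<Longrightarrow> f x v = fscale r v"
proof -
  obtain r where r: "\<And>x v. v \<in> space (indicator_rep {a..b} :: ('p, 'k) prep) x \<Longrightarrow>
      f x v = (if x \<in> {a..b} then fscale r v else 0)"
    using segment_morphism_scalar[OF f] by blast
  show thesis
  proof (rule that)
    show "r \<noteq> 0" using r[OF v] nz by (auto split: if_splits)
    show "f x v = fscale r v" if "v \<in> space (indicator_rep {a..b} :: ('p, 'k) prep) x" for x v
      using r[OF that] that by (auto split: if_splits)
  qed
qed

text \<open>The composite of \<open>g\<close> and \<open>k\<close> is a nonzero scalar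
  \<open>r\<close>; dividing \<open>k\<close> by \<open>r\<close> gives a left inverse of
  \<open>g\<close>.\<close>

lemma is_section_of_nonzero_composite:
  fixes g :: "('p::order, 'k::field) family"
  assumes g: "morphism (indicator_rep {a..b}) U g" and k: "morphism U (indicator_rep {a..b}) k"
    and v: "v \<in> space (indicator_rep {a..b} :: ('p, 'k) prep) x" and nz: "k x (g x v) \<noteq> 0"
  shows "is_section (indicator_rep {a..b}) U g"
proof -
  obtain r where r: "r \<noteq> 0"
    "\<And>x v. v \<in> space (indicator_rep {a..b} :: ('p, 'k) prep) x \<Longrightarrow> k x (g x v) = fscale r v"
    using nonzero_segment_endomorphism_scalar[OF morphism_comp[OF g k] v nz] by blast
  have "morphism U (indicator_rep {a..b}) (\<lambda>x u. fscale (inverse r) (k x u))"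
    by (rule morphism_fscale_comp[OF is_rep_segment k])
  then show ?thesis
    unfolding is_section_def using r
    by (intro exI[of _ "\<lambda>x u. fscale (inverse r) (k x u)"]) simp
qed

lemma is_retraction_of_nonzero_composite:
  fixes h :: "('p::order, 'k::field) family"
  assumes U: "is_rep U"
    and k: "morphism (indicator_rep {a..b}) U k" and h: "morphism U (indicator_rep {a..b}) h"
    and v: "v \<in> space (indicator_rep {a..b} :: ('p, 'k) prep) x" and nz: "h x (k x v) \<noteq> 0"
  shows "is_retraction U (indicator_rep {a..b}) h"
proof -
  obtain r where r: "r \<noteq> 0"
    "\<And>x v. v \<in> space (indicator_rep {a..b} :: ('p, 'k) prep) x \<Longrightarrow> h x (k x v) = fscale r v"
    using nonzero_segment_endomorphism_scalar[OF morphism_comp[OF k h] v nz] by blast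
  have "morphism (indicator_rep {a..b}) U (\<lambda>x u. fscale (inverse r) (k x u))"
    by (rule morphism_fscale_comp[OF U k])
  \<comment> \<open>The scalar sits on \<open>k\<close>, the prospective right inverse, and is
    pulled through \<open>h\<close> by linearity.\<close>
  moreover have "h x (fscale (inverse r) (k x v)) = v"
    if "v \<in> space (indicator_rep {a..b} :: ('p, 'k) prep) x" for x v
    using morphism_fscale[OF h morphism_in_space[OF k that]] r that by simp
  ultimately show ?thesis
    unfolding is_retraction_def
    by (intro exI[of _ "\<lambda>x u. fscale (inverse r) (k x u)"]) simp
qed

text \<open>Both maps are nonzero on the generator, so the inequalities for nonzero morphisms hold
  in both directions and antisymmetry applies. Sections and retractions are both instances of this
  situation.\<close>

lemma segment_eq_of_left_inverse:
  fixes f g :: "('p::order, 'k::field) family"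
  assumes ab: "a \<le> b"
    and f: "morphism (indicator_rep {a..b} :: ('p, 'k) prep) (indicator_rep {c..d}) f"
    and g: "morphism (indicator_rep {c..d} :: ('p, 'k) prep) (indicator_rep {a..b}) g"
    and id: "\<And>x v. v \<in> space (indicator_rep {a..b} :: ('p, 'k) prep) x \<Longrightarrow> g x (f x v) = v"
  shows "a = c \<and> b = d"
proof -
  have u: "base_unit \<in> space (indicator_rep {a..b} :: ('p, 'k) prep) a"
    using ab base_unit_in_base_line by auto
  have gnz: "g a (f a base_unit) \<noteq> 0"
    using id[OF u] base_unit_nonzero by simp
  then have fnz: "f a base_unit \<noteq> 0"
    using morphism_zero[OF is_rep_segment g] by metis
  show ?thesis
    using nonzero_segment_morphism[OF f u fnz]
      nonzero_segment_morphism[OF g morphism_in_space[OF f u] gnz]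
    by (auto intro: antisym)
qed

lemma segment_section_eq:
  assumes "a \<le> b" "morphism (indicator_rep {a..b} :: ('p::order, 'k::field) prep)
    (indicator_rep {c..d}) f"
    and "is_section (indicator_rep {a..b} :: ('p, 'k) prep) (indicator_rep {c..d}) f"
  shows "a = c \<and> b = d"
proof -
  obtain r where "morphism (indicator_rep {c..d} :: ('p, 'k) prep) (indicator_rep {a..b}) r"
    "\<And>x v. v \<in> space (indicator_rep {a..b} :: ('p, 'k) prep) x \<Longrightarrow> r x (f x v) = v"
    using assms(3) unfolding is_section_def by blast
  then show ?thesis by (rule segment_eq_of_left_inverse[OF assms(1,2)])
qed

lemma segment_retraction_eq:
  assumes "c \<le> d" "morphism (indicator_rep {a..b} :: ('p::order, 'k::field) prep)
    (indicator_rep {c..d}) f"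
    and "is_retraction (indicator_rep {a..b} :: ('p, 'k) prep) (indicator_rep {c..d}) f"
  shows "a = c \<and> b = d"
proof -
  obtain s where s: "morphism (indicator_rep {c..d} :: ('p, 'k) prep) (indicator_rep {a..b}) s"
    "\<And>x v. v \<in> space (indicator_rep {c..d} :: ('p, 'k) prep) x \<Longrightarrow> f x (s x v) = v"
    using assms(3) unfolding is_retraction_def by blast
  have "c = a \<and> d = b"
    by (rule segment_eq_of_left_inverse[OF assms(1) s(1) assms(2) s(2)])
  then show ?thesis by simp
qed

lemma segment_in_segment_modules: "a \<le> b \<Longrightarrow> indicator_rep {a..b} \<in> segment_modules"
  by (auto simp: segment_modules_def)

subsection \<open>Irreducible morphisms\<close>

text \<open>The factorisation property is tested on two kinds of middle object:
  \<open>zero_rep\<close>, which shows that \<open>f\<close> is nonzero, and the modules of the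
  segments from \<open>e\<close> to \<open>k\<close>, which bounds the possible pairs.\<close>

lemma irreducible_segment_morphism_imp:
  fixes f :: "('p::order, 'k::field) family"
  assumes ab: "a \<le> b" and cd: "c \<le> d"
    and irr: "irreducible_morphism segment_modules
      (indicator_rep {a..b} :: ('p, 'k) prep) (indicator_rep {c..d}) f"
  shows "c \<le> a" "a \<le> d" "d \<le> b" "(a, b) \<noteq> (c, d)"
    and "\<And>e k. c \<le> e \<Longrightarrow> e \<le> a \<Longrightarrow> d \<le> k \<Longrightarrow> k \<le> b \<Longrightarrow> (e, k) = (a, b) \<or> (e, k) = (c, d)"
proof -
  let ?M = "indicator_rep {a..b} :: ('p, 'k) prep"
  let ?N = "indicator_rep {c..d} :: ('p, 'k) prep"
  have f: "morphism ?M ?N f" and nsec: "\<not> is_section ?M ?N f"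
    and fact: "\<And>U g h. U \<in> add_closure segment_modules \<Longrightarrow> morphism M U g \<Longrightarrow>
      morphism U ?N h \<Longrightarrow> \<forall>x. \<forall>v\<in>space ?M x. f x v = h x (g x v) \<Longrightarrow>
      M = ?M \<Longrightarrow> is_section ?M U g \<or> is_retraction U ?N h" for M
    using irr unfolding irreducible_morphism_def by blast+
  have "\<exists>x. \<exists>v\<in>space ?M x. f x v \<noteq> 0"
  proof (rule ccontr)
    assume "\<not> ?thesis"
    then consider "is_section ?M zero_rep (\<lambda>x v. 0)" | "is_retraction zero_rep ?N (\<lambda>x v. 0)"
      \<comment> \<open>A zero morphism factors through \<open>zero_rep\<close>; either alternative
        would then make a nonzero segment module a retract of zero.\<close>
      using fact[OF zero_rep_in_add_closure morphism_to_zero_rep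
          morphism_from_zero_rep[OF is_rep_segment]] by blast
    then show False
    proof cases
      case 1
      then obtain r where r: "morphism zero_rep ?M r" "\<forall>x. \<forall>v\<in>space ?M x. r x 0 = v"
        unfolding is_section_def by blast
      have "base_unit \<in> space ?M a" using ab base_unit_in_base_line by auto
      then show False
        using r morphism_zero[OF is_rep_zero_rep r(1)] base_unit_nonzero by metis
    next
      case 2
      have "base_unit \<in> space ?N c" using cd base_unit_in_base_line by auto
      then show False
        using 2 base_unit_nonzero unfolding is_retraction_def by metis
    qed
  qed
  then obtain x v where v: "v \<in> space ?M x" and nz: "f x v \<noteq> 0" by blast
  show le: "c \<le> a" "a \<le> d" "d \<le> b"
    using nonzero_segment_morphism[OF f v nz] by blast+
  show "(a, b) \<noteq> (c, d)"
  proof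
    assume "(a, b) = (c, d)"
    then have "a = c" "b = d" by auto
    \<comment> \<open>A nonzero endomorphism is invertible: the section criterion is applied with
      the identity as second factor.\<close>
    then have "is_section ?M ?M f"
      using is_section_of_nonzero_composite[OF f _ v, of "\<lambda>x v. v"] nz
        morphism_id[OF is_rep_segment, of a b] by simp
    then show False using nsec \<open>a = c\<close> \<open>b = d\<close> by simp
  qed
  obtain r where r: "\<And>x v. v \<in> space ?M x \<Longrightarrow> f x v = (if x \<in> {c..d} then fscale r v else 0)"
    using segment_morphism_scalar[OF f] by blast
  fix e k assume ek: "c \<le> e" "e \<le> a" "d \<le> k" "k \<le> b"
  let ?L = "indicator_rep {e..k} :: ('p, 'k) prep"
  have ek': "e \<le> k" using ek le by (meson order_trans)
  \<comment> \<open>Both factors are canonical maps; the scalar \<open>r\<close> of \<open>f\<close>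
    is absorbed into \<open>h\<close>.\<close>
  define g :: "('p, 'k) family" where "g = (\<lambda>x v. if x \<in> {e..k} then v else 0)"
  define h :: "('p, 'k) family" where
    "h = (\<lambda>x v. fscale r (if x \<in> {c..d} then v else 0))"
  have g: "morphism ?M ?L g"
    unfolding g_def by (rule segment_morphism_canonical[OF ek(2,4)])
  have h: "morphism ?L ?N h"
    unfolding h_def
    by (rule morphism_fscale_comp[OF is_rep_segment segment_morphism_canonical[OF ek(1,3)]])
  have "f x v = h x (g x v)" if "v \<in> space ?M x" for x v
    using r[OF that] that ek unfolding g_def h_def
    by (auto split: if_splits dest: order_trans)
  then have "is_section ?M ?L g \<or> is_retraction ?L ?N h"
    using fact[OF in_add_closure[OF is_rep_segment segment_in_segment_modules[OF ek']] g h]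
    by blast
  then show "(e, k) = (a, b) \<or> (e, k) = (c, d)"
    using segment_section_eq[OF ab g] segment_retraction_eq[OF cd h] by auto
qed

text \<open>A factorisation through \<open>U\<close> yields a nonzero one through a single segment
  module. By \<open>only\<close> that module is the source or the target, which makes the first
  factor a section or the second a retraction.\<close>

lemma irreducible_segment_morphismI:
  assumes ab: "a \<le> b" and cd: "c \<le> d" and le: "c \<le> a" "a \<le> d" "d \<le> b"
    and ne: "(a, b) \<noteq> (c, d)"
    and only: "\<And>e k. c \<le> e \<Longrightarrow> e \<le> a \<Longrightarrow> d \<le> k \<Longrightarrow> k \<le> b \<Longrightarrow> (e, k) = (a, b) \<or> (e, k) = (c, d)"
  shows "irreducible_morphism segment_modules
    (indicator_rep {a..b} :: ('p::order, 'k::field) prep) (indicator_rep {c..d})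
    (\<lambda>x v. if x \<in> {c..d} then v else 0)"
    (is "irreducible_morphism _ ?M ?N ?f")
proof -
  have f: "morphism ?M ?N ?f" by (rule segment_morphism_canonical[OF le(1,3)])
  have u: "base_unit \<in> space ?M a" using ab base_unit_in_base_line by auto
  have "is_section ?M U g \<or> is_retraction U ?N h"
    if U: "U \<in> add_closure segment_modules" and g: "morphism ?M U g" and h: "morphism U ?N h"
      and eq: "\<forall>x. \<forall>v\<in>space ?M x. ?f x v = h x (g x v)" for U g h
  proof -
    have repU: "is_rep U" using U by (simp add: add_closure_def)
    have "?f a base_unit \<noteq> 0" using le base_unit_nonzero by simp
    then have "h a (g a base_unit) \<noteq> 0" using eq u by metis
    from nonzero_composite_through_generator[OF U g h u this]
    obtain L j p where L: "L \<in> segment_modules" and j: "morphism U L j" and p: "morphism L U p"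
      and nz: "h a (p a (j a (g a base_unit))) \<noteq> 0" by blast
    obtain e k where Lek: "L = indicator_rep {e..k}" and ek: "e \<le> k"
      using L by (auto simp: segment_modules_def)
    note j = j[unfolded Lek] and p = p[unfolded Lek]
    have jg: "morphism ?M (indicator_rep {e..k}) (\<lambda>x v. j x (g x v))"
      by (rule morphism_comp[OF g j])
    have hp: "morphism (indicator_rep {e..k}) ?N (\<lambda>x v. h x (p x v))"
      by (rule morphism_comp[OF p h])
    have jnz: "j a (g a base_unit) \<noteq> 0"
      using nz morphism_zero[OF is_rep_segment hp, of a] by metis
    \<comment> \<open>Nonvanishing of \<open>jg\<close> gives \<open>e \<le> a\<close> and
      \<open>k \<le> b\<close>; nonvanishing of \<open>hp\<close> gives \<open>c \<le> e\<close> and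
      \<open>d \<le> k\<close>.\<close>
    have "(e, k) = (a, b) \<or> (e, k) = (c, d)"
      using only nonzero_segment_morphism[OF jg u jnz]
        nonzero_segment_morphism[OF hp morphism_in_space[OF jg u] nz] by blast
    then show ?thesis
    proof
      assume "(e, k) = (a, b)"
      then have "morphism U ?M j" using j by simp
      then show ?thesis
        using is_section_of_nonzero_composite[where k = j, OF g _ u jnz] by simp
    next
      assume "(e, k) = (c, d)"
      then have "morphism ?N U p" "j a (g a base_unit) \<in> space ?N a"
        using p morphism_in_space[OF jg u] by auto
      then show ?thesis
        using is_retraction_of_nonzero_composite[where k = p, OF repU _ h _ nz] by simp
    qed
  qed
  then show ?thesis
    unfolding irreducible_morphism_def
    using f ne segment_section_eq[OF ab f] segment_retraction_eq[OF cd f]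
      segment_in_segment_modules[OF ab] segment_in_segment_modules[OF cd] by blast
qed

section \<open>From admissible pairs to covering relations\<close>

theorem proposition6p4:
  fixes a b c d :: "'p::{finite, order}"
  assumes "a \<le> b" and "c \<le> d"
  shows "(\<exists>f. irreducible_morphism (segment_modules :: ('p, 'k::field) prep set)
                (indicator_rep {a..b}) (indicator_rep {c..d}) f) \<longleftrightarrow>
         (\<exists>f. morphism (indicator_rep {a..b} :: ('p, 'k) prep) (indicator_rep {c..d}) f \<and>
            ((injective (indicator_rep {a..b} :: ('p, 'k) prep) f \<and> c \<lessdot> a \<and> a \<le> d \<and> d = b) \<or>
             (surjective (indicator_rep {a..b} :: ('p, 'k) prep) (indicator_rep {c..d}) f \<and>
                c = a \<and> a \<le> d \<and> d \<lessdot> b)))"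
    (is "?irr \<longleftrightarrow> ?rhs")
proof
  let ?f = "(\<lambda>x v. if x \<in> {c..d} then v else 0) :: ('p, 'k) family"
  assume ?irr
  then obtain f where f: "irreducible_morphism (segment_modules :: ('p, 'k) prep set)
                (indicator_rep {a..b}) (indicator_rep {c..d}) f" ..
  note le = irreducible_segment_morphism_imp(1-3)[OF assms f]
  note ne = irreducible_segment_morphism_imp(4)[OF assms f]
  note only = irreducible_segment_morphism_imp(5)[OF assms f]
  have mor: "morphism (indicator_rep {a..b} :: ('p, 'k) prep) (indicator_rep {c..d}) ?f"
    by (rule segment_morphism_canonical[OF le(1,3)])
  \<comment> \<open>The image of a nonzero morphism is the segment module from \<open>a\<close> to
    \<open>d\<close>, so this pair is always admissible; it must agree with one end, leaving only
    one coordinate to change.\<close>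
  have "(a, d) = (a, b) \<or> (a, d) = (c, d)"
    using only[of a d] le by simp
  then consider "d = b" "c < a" | "c = a" "d < b"
    using le ne by (auto simp: less_le)
  then show ?rhs
  proof cases
    case 1
    \<comment> \<open>A point strictly between would give an admissible pair \<open>(y, b)\<close>
      different from both ends.\<close>
    have "\<not> (c < y \<and> y < a)" for y
      using only[of y b] 1 by (auto simp: less_le)
    then have "c \<lessdot> a" using 1 by (simp add: covered_by_def)
    \<comment> \<open>With \<open>c \<le> a\<close> and \<open>d = b\<close> the source segment lies
      inside the target segment, so the canonical map is the identity on every source space.\<close>
    moreover have "injective (indicator_rep {a..b} :: ('p, 'k) prep) ?f"
      using le 1 order_trans[of c a] by (auto simp: injective_def inj_on_def)
    ultimately show ?thesis using mor le 1 by blast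
  next
    case 2
    have "\<not> (d < y \<and> y < b)" for y
      using only[of a y] 2 by (auto simp: less_le)
    then have "d \<lessdot> b" using 2 by (simp add: covered_by_def)
    \<comment> \<open>The target segment lies inside the source segment, so the canonical map is the
      identity over every point of the target.\<close>
    moreover have "x \<in> {a..b}" if "x \<in> {c..d}" for x
      using that 2 order_trans[of x d b] by auto
    then have "surjective (indicator_rep {a..b} :: ('p, 'k) prep) (indicator_rep {c..d}) ?f"
      using zero_in_base_line by (auto simp: surjective_def image_iff)
    ultimately show ?thesis using mor le 2 by blast
  qed
next
  assume ?rhs
  then consider "c \<lessdot> a" "a \<le> d" "d = b" | "c = a" "a \<le> d" "d \<lessdot> b" by blast
  \<comment> \<open>One coordinate of an admissible pair is pinned by antisymmetry; the cover leaves
    only its two endpoints for the other.\<close>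
  then have "c \<le> a \<and> a \<le> d \<and> d \<le> b \<and> (a, b) \<noteq> (c, d) \<and>
    (\<forall>e k. c \<le> e \<longrightarrow> e \<le> a \<longrightarrow> d \<le> k \<longrightarrow> k \<le> b \<longrightarrow> (e, k) = (a, b) \<or> (e, k) = (c, d))"
    by cases (auto simp: covered_by_def less_le)
  then show ?irr
    using irreducible_segment_morphismI[OF assms] by blast
qed

end
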